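(* Let $L$ be an MV-algebra and let $d:L\to L$ be a derivation on $L$. Then the following statements are equivalent: (1) $d$ is an additive derivation, i.e. $d(x\oplus y)=d(x)\oplus d(y)$ for all $x,y\in L$; (2) $d$ is an isotone derivation, i.e. $x\leq y$ implies $d(x)\leq d(y)$ for all $x,y\in L$; (3) $d(x)\leq d(1)$ for all $x\in L$; (4) $d(x)=d(1)\odot x$ for all $x\in L$; (5) $d(x\odot y)=d(x)\odot y=x\odot d(y)$ for all $x,y\in L$; (6) $d(x\wedge y)=d(x)\wedge d(y)$ for all $x,y\in L$; (7) $d(x\vee y)=d(x)\vee d(y)$ for all $x,y\in L$; (8) $d(x\odot y)=d(x)\odot d(y)$ for all $x,y\in L$; (9) for all $x,y\in L$, $d(x)\leq y$ if and only if $d(x)\leq d(y)$; (10) $d(x)\rightarrow d(y)=d(x)\rightarrow y$ for all $x,y\in L$.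
   Context: An MV-algebra is an algebra $(L,\oplus,{}^\ast,0)$ of type $(2,1,0)$ such that $(L,\oplus,0)$ is a commutative monoid, $(x^\ast)^\ast=x$, $0^\ast\oplus x=0^\ast$, and $(x^\ast\oplus y)^\ast\oplus y=(y^\ast\oplus x)^\ast\oplus x$ for all $x,y\in L$. Put $1=0^\ast$, $x\odot y=(x^\ast\oplus y^\ast)^\ast$, $x\rightarrow y=x^\ast\oplus y$, and $x\leq y$ iff $x^\ast\oplus y=1$. This is a lattice order with $x\vee y=(x\odot y^\ast)\oplus y$ and $x\wedge y=x\odot(x^\ast\oplus y)$. A derivation on $L$ is a map $d:L\to L$ with $d(x\odot y)=(d(x)\odot y)\oplus(x\odot d(y))$ for all $x,y\in L$. *)

theory Defs
  imports Main
begin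

class mv_algebra =
  fixes mv_plus :: "'a \<Rightarrow> 'a \<Rightarrow> 'a"  (infixl "\<oplus>" 65)
    and mv_star :: "'a \<Rightarrow> 'a"  ("_\<^sup>\<star>" [1000] 999)
    and mv_zero :: "'a"  ("\<zero>")
  assumes mv_assoc: "(x \<oplus> y) \<oplus> z = x \<oplus> (y \<oplus> z)"
    and mv_commute: "x \<oplus> y = y \<oplus> x"
    and mv_zero_right: "x \<oplus> \<zero> = x"
    and mv_star_star: "(x\<^sup>\<star>)\<^sup>\<star> = x"
    and mv_star_zero: "\<zero>\<^sup>\<star> \<oplus> x = \<zero>\<^sup>\<star>"
    and mv_lukasiewicz: "(x\<^sup>\<star> \<oplus> y)\<^sup>\<star> \<oplus> y = (y\<^sup>\<star> \<oplus> x)\<^sup>\<star> \<oplus> x"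
begin

definition mv_one :: "'a"  ("\<one>")
  where "\<one> = \<zero>\<^sup>\<star>"

definition mv_times :: "'a \<Rightarrow> 'a \<Rightarrow> 'a"  (infixl "\<odot>" 70)
  where "x \<odot> y = (x\<^sup>\<star> \<oplus> y\<^sup>\<star>)\<^sup>\<star>"

definition mv_imp :: "'a \<Rightarrow> 'a \<Rightarrow> 'a"  (infixr "\<rightarrow>" 60)
  where "x \<rightarrow> y = x\<^sup>\<star> \<oplus> y"

definition mv_le :: "'a \<Rightarrow> 'a \<Rightarrow> bool"  (infix "\<sqsubseteq>" 50)
  where "x \<sqsubseteq> y \<longleftrightarrow> x\<^sup>\<star> \<oplus> y = \<one>"

definition mv_less :: "'a \<Rightarrow> 'a \<Rightarrow> bool"  (infix "\<sqsubset>" 50)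
  where "x \<sqsubset> y \<longleftrightarrow> x \<sqsubseteq> y \<and> \<not> y \<sqsubseteq> x"

definition mv_sup :: "'a \<Rightarrow> 'a \<Rightarrow> 'a"  (infixl "\<squnion>" 65)
  where "x \<squnion> y = (x \<odot> y\<^sup>\<star>) \<oplus> y"

definition mv_inf :: "'a \<Rightarrow> 'a \<Rightarrow> 'a"  (infixl "\<sqinter>" 70)
  where "x \<sqinter> y = x \<odot> (x\<^sup>\<star> \<oplus> y)"

lemma mv_one_plus: "\<one> \<oplus> x = \<one>" "x \<oplus> \<one> = \<one>"
  using mv_star_zero[of x] mv_commute[of x "\<one>"] by (simp_all add: mv_one_def)

lemma mv_zero_left: "\<zero> \<oplus> x = x"
  using mv_zero_right[of x] mv_commute[of x] by simp

lemma mv_one_star: "\<one>\<^sup>\<star> = \<zero>"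
  by (simp add: mv_one_def mv_star_star)

lemma mv_star_plus_self: "x\<^sup>\<star> \<oplus> x = \<one>"
  using mv_lukasiewicz[of x "\<one>"] by (simp add: mv_one_plus mv_one_star mv_zero_left)

lemma mv_le_plus: "x \<sqsubseteq> x \<oplus> w"
  by (simp add: mv_le_def mv_assoc[symmetric] mv_star_plus_self mv_one_plus)

lemma mv_le_decomp: "x \<sqsubseteq> y \<Longrightarrow> y = (y\<^sup>\<star> \<oplus> x)\<^sup>\<star> \<oplus> x"
  using mv_lukasiewicz[of x y] by (simp add: mv_le_def mv_one_star mv_zero_left)

lemma mv_le_iff: "x \<sqsubseteq> y \<longleftrightarrow> (\<exists>w. y = x \<oplus> w)"
proof
  assume "x \<sqsubseteq> y"
  from mv_le_decomp[OF this] show "\<exists>w. y = x \<oplus> w"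
    using mv_commute[of x] by auto
qed (auto simp: mv_le_plus)

lemma mv_le_antisym: "x \<sqsubseteq> y \<Longrightarrow> y \<sqsubseteq> x \<Longrightarrow> x = y"
  using mv_le_decomp[of x y] by (simp add: mv_le_def mv_one_star mv_zero_left)

lemma mv_le_trans: "x \<sqsubseteq> y \<Longrightarrow> y \<sqsubseteq> z \<Longrightarrow> x \<sqsubseteq> z"
  by (auto simp: mv_le_iff mv_assoc)

lemma mv_plus_mono: "x \<sqsubseteq> y \<Longrightarrow> x \<oplus> z \<sqsubseteq> y \<oplus> z"
proof -
  assume "x \<sqsubseteq> y"
  then obtain w where w: "y = x \<oplus> w" by (auto simp: mv_le_iff)
  have "y \<oplus> z = (x \<oplus> z) \<oplus> w"
    using mv_commute[of w z] by (simp add: w mv_assoc)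
  then show ?thesis by (simp add: mv_le_plus)
qed

lemma mv_star_antimono: "x \<sqsubseteq> y \<Longrightarrow> y\<^sup>\<star> \<sqsubseteq> x\<^sup>\<star>"
  using mv_commute[of y "x\<^sup>\<star>"] by (simp add: mv_le_def mv_star_star)

lemma mv_sup_eq: "x \<squnion> y = (x\<^sup>\<star> \<oplus> y)\<^sup>\<star> \<oplus> y"
  by (simp add: mv_sup_def mv_times_def mv_star_star)

lemma mv_sup_commute: "x \<squnion> y = y \<squnion> x"
  using mv_lukasiewicz by (simp add: mv_sup_eq)

lemma mv_sup_ge: "x \<sqsubseteq> x \<squnion> y" "y \<sqsubseteq> x \<squnion> y"
proof -
  have *: "v \<sqsubseteq> u \<squnion> v" for u v
    unfolding mv_le_iff mv_sup_eq using mv_commute by blast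
  show "y \<sqsubseteq> x \<squnion> y" by (fact *)
  show "x \<sqsubseteq> x \<squnion> y" using *[of x y] by (simp add: mv_sup_commute)
qed

lemma mv_sup_least:
  assumes "x \<sqsubseteq> z" "y \<sqsubseteq> z"
  shows "x \<squnion> y \<sqsubseteq> z"
proof -
  have "(x\<^sup>\<star> \<oplus> y)\<^sup>\<star> \<sqsubseteq> (z\<^sup>\<star> \<oplus> y)\<^sup>\<star>"
    by (intro mv_star_antimono mv_plus_mono assms(1))
  from mv_plus_mono[OF this, of y] show ?thesis
    using mv_le_decomp[OF assms(2)] by (simp add: mv_sup_eq)
qed

lemma mv_inf_eq: "x \<sqinter> y = (x\<^sup>\<star> \<squnion> y\<^sup>\<star>)\<^sup>\<star>"
proof -
  have "x\<^sup>\<star> \<squnion> y\<^sup>\<star> = (y \<oplus> x\<^sup>\<star>)\<^sup>\<star> \<oplus> x\<^sup>\<star>"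
    using mv_sup_commute[of "x\<^sup>\<star>" "y\<^sup>\<star>"] by (simp add: mv_sup_eq mv_star_star)
  also have "\<dots> = x\<^sup>\<star> \<oplus> (x\<^sup>\<star> \<oplus> y)\<^sup>\<star>"
    by (simp add: mv_commute[of y] mv_commute[of "(x\<^sup>\<star> \<oplus> y)\<^sup>\<star>"])
  finally show ?thesis by (simp add: mv_inf_def mv_times_def)
qed

lemma mv_le_star_iff: "x \<sqsubseteq> y\<^sup>\<star> \<longleftrightarrow> y \<sqsubseteq> x\<^sup>\<star>"
  using mv_commute[of "x\<^sup>\<star>" "y\<^sup>\<star>"] by (simp add: mv_le_def)

lemma mv_star_le_iff: "x\<^sup>\<star> \<sqsubseteq> y \<longleftrightarrow> y\<^sup>\<star> \<sqsubseteq> x"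
  using mv_commute[of x y] by (simp add: mv_le_def mv_star_star)

text \<open>The order is a lattice order, with meet and join given by the formulas above.\<close>

sublocale mv: lattice mv_inf mv_le mv_less mv_sup
proof
  fix x y z :: 'a
  show "x \<sqsubset> y \<longleftrightarrow> x \<sqsubseteq> y \<and> \<not> y \<sqsubseteq> x" by (fact mv_less_def)
  show "x \<sqsubseteq> x" by (simp add: mv_le_def mv_star_plus_self)
  show "x \<sqsubseteq> y \<Longrightarrow> y \<sqsubseteq> z \<Longrightarrow> x \<sqsubseteq> z" by (fact mv_le_trans)
  show "x \<sqsubseteq> y \<Longrightarrow> y \<sqsubseteq> x \<Longrightarrow> x = y" by (fact mv_le_antisym)
  show "x \<sqinter> y \<sqsubseteq> x" "x \<sqinter> y \<sqsubseteq> y"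
    by (simp_all add: mv_inf_eq mv_star_le_iff mv_sup_ge)
  show "x \<sqsubseteq> y \<Longrightarrow> x \<sqsubseteq> z \<Longrightarrow> x \<sqsubseteq> y \<sqinter> z"
    by (simp add: mv_inf_eq mv_le_star_iff[of x] mv_sup_least mv_star_antimono)
  show "x \<sqsubseteq> x \<squnion> y" "y \<sqsubseteq> x \<squnion> y" by (fact mv_sup_ge)+
  show "y \<sqsubseteq> x \<Longrightarrow> z \<sqsubseteq> x \<Longrightarrow> y \<squnion> z \<sqsubseteq> x" by (fact mv_sup_least)
qed

definition derivation :: "('a \<Rightarrow> 'a) \<Rightarrow> bool"
  where "derivation d \<longleftrightarrow> (\<forall>x y. d (x \<odot> y) = (d x \<odot> y) \<oplus> (x \<odot> d y))"

definition additive_derivation :: "('a \<Rightarrow> 'a) \<Rightarrow> bool"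
  where "additive_derivation d \<longleftrightarrow> derivation d \<and> (\<forall>x y. d (x \<oplus> y) = d x \<oplus> d y)"

definition isotone_derivation :: "('a \<Rightarrow> 'a) \<Rightarrow> bool"
  where "isotone_derivation d \<longleftrightarrow> derivation d \<and> (\<forall>x y. x \<sqsubseteq> y \<longrightarrow> d x \<sqsubseteq> d y)"

end

definition all_equivalent :: "bool list \<Rightarrow> bool"
  where "all_equivalent Ps \<longleftrightarrow> (\<forall>P\<in>set Ps. \<forall>Q\<in>set Ps. P \<longleftrightarrow> Q)"

end

theory Submission
  imports Defs
begin

text \<open>
  From \<open>d \<zero> = \<zero>\<close> and \<open>x \<odot> x\<^sup>\<star> = \<zero>\<close> one gets \<open>d x \<sqsubseteq> x\<close>. Writing \<open>a = d \<one>\<close>, the derivation rule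
  for \<open>\<one> \<odot> \<one>\<close> makes \<open>a\<close> idempotent, i.e. a Boolean element, and the rule for \<open>x \<odot> \<one>\<close> gives
  \<open>a \<odot> x \<sqsubseteq> d x\<close>. Since \<open>a \<odot> x = a \<sqinter> x\<close> for Boolean \<open>a\<close>, condition (3) forces \<open>d x = a \<odot> x\<close>.
  Conversely, \<open>x \<mapsto> a \<sqinter> x\<close> preserves all the operations in question, and each of the other
  conditions yields (3) after substituting \<open>\<one>\<close> for a variable.
\<close>

context mv_algebra
begin

section \<open>Bounds and monotonicity of addition\<close>

lemma mv_zero_le: "\<zero> \<sqsubseteq> x"
  using mv_le_plus[of \<zero> x] by (simp add: mv_zero_left)

lemma mv_le_one: "x \<sqsubseteq> \<one>"
  by (simp add: mv_le_def mv_one_plus)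

lemma mv_le_zero: "x \<sqsubseteq> \<zero> \<Longrightarrow> x = \<zero>"
  by (simp add: mv_le_antisym mv_zero_le)

lemma mv_le_plus_left: "x \<sqsubseteq> w \<oplus> x"
  using mv_le_plus[of x w] by (simp add: mv_commute)

lemma mv_plus_eq_zero: "x \<oplus> y = \<zero> \<Longrightarrow> x = \<zero>"
  using mv_le_plus[of x y] by (simp add: mv_le_zero)

lemma mv_plus_mono2: "x \<sqsubseteq> y \<Longrightarrow> u \<sqsubseteq> v \<Longrightarrow> x \<oplus> u \<sqsubseteq> y \<oplus> v"
  by (metis mv_plus_mono mv_commute mv_le_trans)

lemma mv_plus_left_commute: "x \<oplus> (y \<oplus> z) = y \<oplus> (x \<oplus> z)"
  by (metis mv_assoc mv_commute)

lemmas mv_plus_ac = mv_assoc mv_commute mv_plus_left_commute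

section \<open>The product and its residuation\<close>

lemma mv_times_commute: "x \<odot> y = y \<odot> x"
  by (simp add: mv_times_def mv_commute)

lemma mv_times_assoc: "(x \<odot> y) \<odot> z = x \<odot> (y \<odot> z)"
  by (simp add: mv_times_def mv_star_star mv_assoc)

lemma mv_times_left_commute: "x \<odot> (y \<odot> z) = y \<odot> (x \<odot> z)"
  by (metis mv_times_assoc mv_times_commute)

lemmas mv_times_ac = mv_times_assoc mv_times_commute mv_times_left_commute

lemma mv_times_zero: "x \<odot> \<zero> = \<zero>" "\<zero> \<odot> x = \<zero>"
  by (simp_all add: mv_times_def mv_one_def[symmetric] mv_one_plus mv_one_star)

lemma mv_times_one: "x \<odot> \<one> = x" "\<one> \<odot> x = x"
  by (simp_all add: mv_times_def mv_one_star mv_zero_right mv_zero_left mv_star_star)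

lemma mv_times_star_self: "x \<odot> x\<^sup>\<star> = \<zero>"
  by (simp add: mv_times_def mv_star_star mv_star_plus_self mv_one_star)

lemma mv_le_iff_times_star: "x \<sqsubseteq> y \<longleftrightarrow> x \<odot> y\<^sup>\<star> = \<zero>"
  by (metis mv_le_def mv_times_def mv_star_star mv_one_star mv_one_def)

text \<open>Up to reordering, both sides unfold to
  \<open>x\<^sup>\<star> \<oplus> y\<^sup>\<star> \<oplus> z = \<one>\<close>.\<close>

lemma mv_residuation: "x \<odot> y \<sqsubseteq> z \<longleftrightarrow> y \<sqsubseteq> x\<^sup>\<star> \<oplus> z"
  by (simp add: mv_le_def mv_times_def mv_star_star mv_plus_ac)

lemma mv_times_mono_right: "x \<sqsubseteq> y \<Longrightarrow> a \<odot> x \<sqsubseteq> a \<odot> y"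
  by (metis mv_residuation mv.order_refl mv_le_trans)

lemma mv_times_le: "x \<odot> y \<sqsubseteq> x" "x \<odot> y \<sqsubseteq> y"
proof -
  show *: "x \<odot> y \<sqsubseteq> y" for x y
    by (simp add: mv_residuation mv_le_plus_left)
  show "x \<odot> y \<sqsubseteq> x"
    using *[of y x] by (simp add: mv_times_commute)
qed

text \<open>By residuation, multiplication by \<open>a\<close> is a left adjoint, so it preserves
  joins.\<close>

lemma mv_times_sup: "a \<odot> (x \<squnion> y) = (a \<odot> x) \<squnion> (a \<odot> y)"
proof (rule mv_le_antisym)
  show "a \<odot> (x \<squnion> y) \<sqsubseteq> (a \<odot> x) \<squnion> (a \<odot> y)"
    unfolding mv_residuation
    by (rule mv_sup_least) (simp_all add: mv_residuation[symmetric])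
  show "(a \<odot> x) \<squnion> (a \<odot> y) \<sqsubseteq> a \<odot> (x \<squnion> y)"
    by (intro mv_sup_least mv_times_mono_right mv_sup_ge)
qed

section \<open>Idempotent (Boolean) elements\<close>

lemma mv_idem_times_self:
  assumes "a \<oplus> a = a"
  shows "a \<odot> a = a"
proof -
  have "a\<^sup>\<star> \<squnion> a = \<one>"
    by (simp add: mv_sup_eq mv_star_star assms mv_star_plus_self)
  \<comment> \<open>Swapping the arguments of the join gives it this second form, which bounds
    \<open>a\<close> by \<open>a \<odot> a\<close>.\<close>
  then have "(a \<odot> a) \<oplus> a\<^sup>\<star> = \<one>"
    by (metis mv_sup_commute mv_sup_def mv_star_star)
  then have "a \<sqsubseteq> a \<odot> a"
    by (simp add: mv_le_def mv_commute)
  then show ?thesis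
    by (simp add: mv_le_antisym mv_times_le)
qed

lemma mv_idem_star:
  assumes "a \<oplus> a = a"
  shows "a\<^sup>\<star> \<oplus> a\<^sup>\<star> = a\<^sup>\<star>"
  using mv_idem_times_self[OF assms] by (metis mv_times_def mv_star_star)

text \<open>The meet \<open>a \<odot> (a\<^sup>\<star> \<oplus> x)\<close> already has a factor
  \<open>a\<close>; idempotence lets it be duplicated, and
  \<open>a \<sqinter> x \<sqsubseteq> x\<close> does the rest.\<close>

lemma mv_idem_times_eq_inf:
  assumes "a \<oplus> a = a"
  shows "a \<odot> x = a \<sqinter> x"
proof (rule mv_le_antisym)
  show "a \<odot> x \<sqsubseteq> a \<sqinter> x"
    by (simp add: mv_times_le)
  have "a \<sqinter> x = a \<odot> (a \<sqinter> x)"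
    by (simp add: mv_inf_def mv_times_assoc[symmetric] mv_idem_times_self[OF assms])
  also have "\<dots> \<sqsubseteq> a \<odot> x"
    by (simp add: mv_times_mono_right)
  finally show "a \<sqinter> x \<sqsubseteq> a \<odot> x" .
qed

lemma mv_idem_times_inf:
  assumes "a \<oplus> a = a"
  shows "a \<odot> (x \<sqinter> y) = (a \<odot> x) \<sqinter> (a \<odot> y)"
  by (simp add: mv_idem_times_eq_inf[OF assms] mv.inf_left_commute mv.inf_assoc)

text \<open>Residuation gives \<open>x \<sqsubseteq> a\<^sup>\<star> \<oplus> (a \<odot> x)\<close>;
  adding \<open>a\<^sup>\<star>\<close> changes nothing on the right, since
  \<open>a\<^sup>\<star>\<close> is idempotent too.\<close>

lemma mv_idem_star_plus_times:
  assumes "a \<oplus> a = a"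
  shows "a\<^sup>\<star> \<oplus> (a \<odot> x) = a\<^sup>\<star> \<oplus> x"
proof (rule mv_le_antisym)
  show "a\<^sup>\<star> \<oplus> (a \<odot> x) \<sqsubseteq> a\<^sup>\<star> \<oplus> x"
    by (simp add: mv_plus_mono2 mv_times_le)
  have "x \<sqsubseteq> a\<^sup>\<star> \<oplus> (a \<odot> x)"
    by (simp add: mv_residuation[symmetric])
  then have "a\<^sup>\<star> \<oplus> x \<sqsubseteq> a\<^sup>\<star> \<oplus> (a\<^sup>\<star> \<oplus> (a \<odot> x))"
    by (simp add: mv_plus_mono2)
  then show "a\<^sup>\<star> \<oplus> x \<sqsubseteq> a\<^sup>\<star> \<oplus> (a \<odot> x)"
    by (simp add: mv_assoc[symmetric] mv_idem_star[OF assms])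
qed

text \<open>For one inequality, residuate and split \<open>a\<^sup>\<star>\<close> into two copies,
  one for each summand. For the other, the sum lies below both \<open>a \<oplus> a = a\<close> and
  \<open>x \<oplus> y\<close>, hence below their meet.\<close>

lemma mv_idem_times_plus:
  assumes "a \<oplus> a = a"
  shows "a \<odot> (x \<oplus> y) = (a \<odot> x) \<oplus> (a \<odot> y)"
proof (rule mv_le_antisym)
  have "a\<^sup>\<star> \<oplus> ((a \<odot> x) \<oplus> (a \<odot> y)) = (a\<^sup>\<star> \<oplus> a\<^sup>\<star>) \<oplus> ((a \<odot> x) \<oplus> (a \<odot> y))"
    by (simp add: mv_idem_star[OF assms])
  also have "\<dots> = (a\<^sup>\<star> \<oplus> (a \<odot> x)) \<oplus> (a\<^sup>\<star> \<oplus> (a \<odot> y))"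
    by (simp add: mv_plus_ac)
  also have "\<dots> = (a\<^sup>\<star> \<oplus> x) \<oplus> (a\<^sup>\<star> \<oplus> y)"
    by (simp add: mv_idem_star_plus_times[OF assms])
  finally show "a \<odot> (x \<oplus> y) \<sqsubseteq> (a \<odot> x) \<oplus> (a \<odot> y)"
    by (simp add: mv_residuation mv_plus_mono2 mv_le_plus_left)
  have "(a \<odot> x) \<oplus> (a \<odot> y) \<sqsubseteq> a \<oplus> a"
    by (intro mv_plus_mono2 mv_times_le)
  moreover have "(a \<odot> x) \<oplus> (a \<odot> y) \<sqsubseteq> x \<oplus> y"
    by (intro mv_plus_mono2 mv_times_le)
  ultimately show "(a \<odot> x) \<oplus> (a \<odot> y) \<sqsubseteq> a \<odot> (x \<oplus> y)"
    by (simp add: mv_idem_times_eq_inf[OF assms] assms)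
qed

section \<open>Derivations and their value at the unit\<close>

lemma derivation_times: "derivation d \<Longrightarrow> d (x \<odot> y) = (d x \<odot> y) \<oplus> (x \<odot> d y)"
  by (simp add: derivation_def)

lemma derivation_zero:
  assumes "derivation d"
  shows "d \<zero> = \<zero>"
  using derivation_times[OF assms, of \<zero> \<zero>]
  by (simp add: mv_times_zero mv_zero_right)

lemma derivation_le:
  assumes "derivation d"
  shows "d x \<sqsubseteq> x"
proof -
  have "(d x \<odot> x\<^sup>\<star>) \<oplus> (x \<odot> d (x\<^sup>\<star>)) = \<zero>"
    by (metis derivation_times[OF assms] mv_times_star_self derivation_zero[OF assms])
  then show ?thesis
    \<comment> \<open>A vanishing sum has a vanishing first summand, and
      \<open>d x \<odot> x\<^sup>\<star> = \<zero>\<close> is the order relation.\<close>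
    unfolding mv_le_iff_times_star by (rule mv_plus_eq_zero)
qed

lemma derivation_one_idem:
  assumes "derivation d"
  shows "d \<one> \<oplus> d \<one> = d \<one>"
  using derivation_times[OF assms, of \<one> \<one>]
  by (simp add: mv_times_one)

lemma derivation_ge:
  assumes "derivation d"
  shows "d \<one> \<odot> x \<sqsubseteq> d x"
  using derivation_times[OF assms, of \<one> x] mv_le_plus[of "d \<one> \<odot> x" "d x"]
  by (simp add: mv_times_one)

lemma derivation_eq_times:
  assumes "derivation d" "d x \<sqsubseteq> d \<one>"
  shows "d x = d \<one> \<odot> x"
proof (rule mv_le_antisym)
  show "d x \<sqsubseteq> d \<one> \<odot> x"
    by (simp add: mv_idem_times_eq_inf derivation_one_idem derivation_le assms)
qed (simp add: derivation_ge assms)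

end

theorem theorem3p10:
  fixes d :: "'a::mv_algebra \<Rightarrow> 'a"
  assumes "derivation d"
  shows "all_equivalent
    [additive_derivation d,
     isotone_derivation d,
     \<forall>x. d x \<sqsubseteq> d \<one>,
     \<forall>x. d x = d \<one> \<odot> x,
     \<forall>x y. d (x \<odot> y) = d x \<odot> y \<and> d x \<odot> y = x \<odot> d y,
     \<forall>x y. d (x \<sqinter> y) = d x \<sqinter> d y,
     \<forall>x y. d (x \<squnion> y) = d x \<squnion> d y,
     \<forall>x y. d (x \<odot> y) = d x \<odot> d y,
     \<forall>x y. d x \<sqsubseteq> y \<longleftrightarrow> d x \<sqsubseteq> d y,
     \<forall>x y. (d x \<rightarrow> d y) = (d x \<rightarrow> y)]"
proof -
  let ?P3 = "\<forall>x. d x \<sqsubseteq> d \<one>"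
  have idem: "d \<one> \<oplus> d \<one> = d \<one>"
    using assms by (rule derivation_one_idem)
  have 4: "?P3 \<longleftrightarrow> (\<forall>x. d x = d \<one> \<odot> x)"
    using derivation_eq_times[OF assms] mv_times_le(1) by metis
  \<comment> \<open>Naming \<open>d \<one>\<close> by a fresh \<open>a\<close> keeps rewriting with
    \<open>d x = a \<odot> x\<close> from looping on \<open>d \<one>\<close>.\<close>
  have repr: "\<exists>a. a \<oplus> a = a \<and> (\<forall>x. d x = a \<odot> x)" if ?P3
    using that 4 idem by blast
  have isotone: "isotone_derivation d \<Longrightarrow> ?P3"
    by (auto simp: isotone_derivation_def mv_le_one)
  have 1: "?P3 \<longleftrightarrow> additive_derivation d"
  proof
    assume ?P3
    then obtain a where a: "a \<oplus> a = a" and d: "\<And>x. d x = a \<odot> x"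
      using repr by blast
    have "d (x \<oplus> y) = d x \<oplus> d y" for x y
      by (simp add: d mv_idem_times_plus[OF a])
    with assms show "additive_derivation d"
      by (simp add: additive_derivation_def)
  next
    assume "additive_derivation d"
    \<comment> \<open>The order is witnessed by sums: \<open>x \<sqsubseteq> y\<close> means
      \<open>y = x \<oplus> w\<close> for some \<open>w\<close>.\<close>
    then have "isotone_derivation d"
      by (auto simp: additive_derivation_def isotone_derivation_def mv_le_iff)
    then show ?P3 by (rule isotone)
  qed
  have 2: "?P3 \<longleftrightarrow> isotone_derivation d"
  proof
    assume ?P3
    then obtain a where a: "a \<oplus> a = a" and d: "\<And>x. d x = a \<odot> x"
      using repr by blast
    have "d x \<sqsubseteq> d y" if "x \<sqsubseteq> y" for x y
      by (simp add: d mv_times_mono_right[OF that])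
    with assms show "isotone_derivation d"
      by (simp add: isotone_derivation_def)
  qed (rule isotone)
  have 5: "?P3 \<longleftrightarrow> (\<forall>x y. d (x \<odot> y) = d x \<odot> y \<and> d x \<odot> y = x \<odot> d y)" (is "_ \<longleftrightarrow> ?P5")
  proof
    assume ?P3
    then obtain a where a: "a \<oplus> a = a" and d: "\<And>x. d x = a \<odot> x"
      using repr by blast
    show ?P5
      by (simp add: d mv_times_assoc mv_times_left_commute)
  next
    assume ?P5
    then have "d (\<one> \<odot> x) = d \<one> \<odot> x" for x by blast
    then show ?P3 by (metis mv_times_one(2) mv_times_le(1))
  qed
  have 6: "?P3 \<longleftrightarrow> (\<forall>x y. d (x \<sqinter> y) = d x \<sqinter> d y)" (is "_ \<longleftrightarrow> ?P6")
  proof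
    assume ?P3
    then obtain a where a: "a \<oplus> a = a" and d: "\<And>x. d x = a \<odot> x"
      using repr by blast
    show ?P6
      by (simp add: d mv_idem_times_inf[OF a])
  next
    assume ?P6
    then have "d x = d x \<sqinter> d \<one>" for x
      by (metis mv.inf.absorb1 mv_le_one)
    then show ?P3 by (metis mv.inf_le2)
  qed
  have 7: "?P3 \<longleftrightarrow> (\<forall>x y. d (x \<squnion> y) = d x \<squnion> d y)" (is "_ \<longleftrightarrow> ?P7")
  proof
    assume ?P3
    then obtain a where a: "a \<oplus> a = a" and d: "\<And>x. d x = a \<odot> x"
      using repr by blast
    show ?P7
      by (simp add: d mv_times_sup)
  next
    assume ?P7
    then have "d \<one> = d x \<squnion> d \<one>" for x
      by (metis mv.sup.absorb2 mv_le_one)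
    then show ?P3 by (metis mv.sup_ge1)
  qed
  have 8: "?P3 \<longleftrightarrow> (\<forall>x y. d (x \<odot> y) = d x \<odot> d y)" (is "_ \<longleftrightarrow> ?P8")
  proof
    assume ?P3
    then obtain a where a: "a \<oplus> a = a" and d: "\<And>x. d x = a \<odot> x"
      using repr by blast
    have "d x \<odot> d y = (a \<odot> a) \<odot> (x \<odot> y)" for x y
      by (simp add: d mv_times_ac)
    then show ?P8
      by (simp add: d mv_idem_times_self[OF a])
  next
    assume ?P8
    then have "d (x \<odot> \<one>) = d x \<odot> d \<one>" for x by blast
    then show ?P3 by (metis mv_times_one(1) mv_times_le(2))
  qed
  have 9: "?P3 \<longleftrightarrow> (\<forall>x y. d x \<sqsubseteq> y \<longleftrightarrow> d x \<sqsubseteq> d y)" (is "_ \<longleftrightarrow> ?P9")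
  proof
    assume ?P3
    \<comment> \<open>Here \<open>d x\<close> lies below both \<open>d \<one>\<close> and
      \<open>y\<close>, and the product with the idempotent \<open>d \<one>\<close> is their
      meet.\<close>
    then have "d x \<sqsubseteq> d \<one> \<odot> y" if "d x \<sqsubseteq> y" for x y
      using that by (simp add: mv_idem_times_eq_inf[OF idem])
    then have "d x \<sqsubseteq> d y" if "d x \<sqsubseteq> y" for x y
      using that derivation_ge[OF assms] by (blast intro: mv_le_trans)
    moreover have "d x \<sqsubseteq> y" if "d x \<sqsubseteq> d y" for x y
      using that derivation_le[OF assms, of y] by (rule mv_le_trans)
    ultimately show ?P9 by blast
  \<comment> \<open>At \<open>y = \<one>\<close> the left side of the equivalence always
    holds.\<close>
  qed (simp add: mv_le_one)
  have 10: "?P3 \<longleftrightarrow> (\<forall>x y. (d x \<rightarrow> d y) = (d x \<rightarrow> y))" (is "_ \<longleftrightarrow> ?P10")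
  proof
    assume ?P3
    then obtain a where a: "a \<oplus> a = a" and d: "\<And>x. d x = a \<odot> x"
      using repr by blast
    \<comment> \<open>This exposes a summand \<open>a\<^sup>\<star>\<close>, next to which
      \<open>a \<odot> y\<close> may be replaced by \<open>y\<close>.\<close>
    have "(d x)\<^sup>\<star> = x\<^sup>\<star> \<oplus> a\<^sup>\<star>" for x
      by (simp add: d mv_times_def mv_star_star mv_commute)
    then show ?P10
      by (simp add: mv_imp_def mv_assoc d mv_idem_star_plus_times[OF a])
  next
    assume ?P10
    then have "(d x \<rightarrow> d \<one>) = (d x \<rightarrow> \<one>)" for x by blast
    then show ?P3 by (simp add: mv_imp_def mv_le_def mv_one_plus)
  qed
  show ?thesis
    \<comment> \<open>Each listed condition is rewritten to \<open>?P3\<close>, so only trivial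
      equivalences remain.\<close>
    unfolding all_equivalent_def
    by (simp only: 1[symmetric] 2[symmetric] 4[symmetric] 5[symmetric] 6[symmetric] 7[symmetric]
        8[symmetric] 9[symmetric] 10[symmetric] list.set ball_simps simp_thms)
qed

end
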